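(* Let $\epsilon\in(0,1]$ and run the VC-LB Algorithm (defined in the context) with step-sizes $$\alpha=\frac1L\quad\text{and}\quad \beta=\frac{\epsilon}{4N^{3/2}L},\qquad\text{where } L=\max_{i=1,\ldots,N}2\left(\lambda_i(A)+\frac1{\lambda_i(A)}\right).$$ Then there exists $T\in\mathbb{N}$ (with $0\in\mathbb N$) such that $\mathrm{fes}(q(T))\le\epsilon$, where $T$ is upper bounded by $$T\le\left\lceil\frac{16N^3LQ\lambda_{\max}(A)}{\epsilon^2}\right\rceil,$$ with $Q=\max\{(q_i^{\min})^2,(q_i^{\max})^2: i=1,\ldots,N\}$.
   Context: Network. Let $N\ge1$, $\mathcal N=\{1,\ldots,N\}$, and let $\mathcal E$ be the directed edge set of a tree on $\{0\}\cup\mathcal N$ rooted at $0$ (edges point from parent to child). Each edge $(h,k)$ has a reactance $x_{hk}>0$. Let $\mathcal P_i\subseteq\mathcal E$ be the set of edges on the path from $0$ to $i$. Define $A\in\mathbb{R}^{N\times N}$ by $A_{ij}=2\sum_{(h,k)\in\mathcal P_i\cap\mathcal P_j}x_{hk}$; it is symmetric positive definite. Its eigenvalues are $\lambda_1(A),\ldots,\lambda_N(A)$ and $\lambda_{\max}(A)=\max_i|\lambda_i(A)|$. Voltage regulation problem. Fix $d\in\mathbb R^N$ and vectors $v^{\min},v^{\max},q^{\min},q^{\max}\in\mathbb R^N$. For $q\in\mathbb R^N$ (reactive power injections) let $v(q)=Aq+d$ (squared voltage magnitudes). The problem is to find $q$ with $q^{\min}\le q\le q^{\max}$ and $v^{\min}\le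 v(q)\le v^{\max}$ (componentwise). Standing assumption: such a $q$ exists. Feasibility measure. $\mathrm{fes}(q)=\mathrm{dist}\big((q,v(q)),\mathcal Q\times\mathcal V\big)$, where $\mathcal Q=[q^{\min},q^{\max}]$ and $\mathcal V=[v^{\min},v^{\max}]$ are boxes in $\mathbb R^N$ and $\mathrm{dist}(x,\mathcal X)=\inf_{y\in\mathcal X}\|x-y\|$ with the Euclidean norm. VC-LB Algorithm. $\lceil\cdot\rceil_+$ denotes projection onto the nonnegative orthant, and $\mathrm{sign}$ is applied componentwise with values in $\{-1,1\}$ (with $\mathrm{sign}(0)$ a fixed element of $\{-1,1\}$). Given step-sizes $\alpha,\beta>0$, the algorithm maintains dual variables $\lambda(t)=(\lambda^{\min}(t),\lambda^{\max}(t))$ and $\mu(t)=(\mu^{\min}(t),\mu^{\max}(t))$ in $\mathbb R^{2N}_+$, with $\lambda(0)=\mu(0)=0$. For $t=0,1,2,\ldots$ it sets $$q(t)=\lambda^{\min}(t)-\lambda^{\max}(t)+A^{-1}\big(\mu^{\min}(t)-\mu^{\max}(t)\big),$$ $$\lambda^{\min}(t+1)=\lceil\lambda^{\min}(t)+\alpha(v^{\min}-v(q(t)))\rceil_+,\quad \lambda^{\max}(t+1)=\lceil\lambda^{\max}(t)+\alpha(v(q(t))-v^{\max})\rceil_+,$$ $$\mu^{\min}(t+1)=\lceil\mu^{\min}(t)+\beta\,\mathrm{sign}(q^{\min}-q(t))\rceil_+,\quad \mu^{\max}(t+1)=\lceil\mu^{\max}(t)+\beta\,\mathrm{sign}(q(t)-q^{\max})\rceil_+.$$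 At each iteration each bus $i$ communicates to its neighbours only the two bits $\mathrm{sign}(q_i^{\min}-q_i(t))$ and $\mathrm{sign}(q_i(t)-q_i^{\max})$. *)

theory Defs
  imports "HOL-Analysis.Analysis" "Graph_Theory.Arc_Walk"
begin

text \<open>
  Buses are the elements of a finite type \<open>'n\<close>, so \<open>N = CARD('n)\<close> is arbitrary and positive. The
  vertices of the network are \<open>'n option\<close>, where \<^term>\<open>None\<close> is the root (substation) \<open>0\<close>.
\<close>

definition network :: "('n option \<times> 'n option) set \<Rightarrow> ('n option, 'n option \<times> 'n option) pre_digraph"
  where "network E = \<lparr>verts = UNIV, arcs = E, tail = fst, head = snd\<rparr>"

text \<open>
  A tree rooted at \<^term>\<open>None\<close> with edges pointing from parent to child: the root has no parent,
  every other vertex has exactly one, and every vertex is a descendant of the root. The predicate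
  \<open>tree\<close> of the graph library is not usable for oriented edges: it only excludes directed cycles.
\<close>

definition rooted_tree :: "('n option \<times> 'n option) set \<Rightarrow> bool" where
  "rooted_tree E \<longleftrightarrow>
     (\<forall>h. (h, None) \<notin> E) \<and>
     (\<forall>i. \<exists>!h. (h, Some i) \<in> E) \<and>
     (\<forall>v. None \<rightarrow>\<^sup>*\<^bsub>network E\<^esub> v)"

definition path_edges :: "('n option \<times> 'n option) set \<Rightarrow> 'n \<Rightarrow> ('n option \<times> 'n option) set" where
  "path_edges E i = {e. \<exists>p. pre_digraph.apath (network E) None p (Some i) \<and> e \<in> set p}"

definition sens_matrix ::
  "('n option \<times> 'n option) set \<Rightarrow> ('n option \<times> 'n option \<Rightarrow> real) \<Rightarrow> real^'n^'n::finite" where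
  "sens_matrix E x = (\<chi> i j. 2 * (\<Sum>e\<in>path_edges E i \<inter> path_edges E j. x e))"

text \<open>Real eigenvalues suffice, since the definition is only applied to symmetric matrices.\<close>

definition eigenvals :: "real^'n^'n::finite \<Rightarrow> real set" where
  "eigenvals A = {l. \<exists>w. w \<noteq> 0 \<and> A *v w = l *\<^sub>R w}"

definition lambda_max :: "real^'n^'n::finite \<Rightarrow> real" where
  "lambda_max A = (MAX l\<in>eigenvals A. \<bar>l\<bar>)"

definition voltage :: "real^'n^'n \<Rightarrow> real^'n \<Rightarrow> real^'n \<Rightarrow> real^'n::finite" where
  "voltage A d q = A *v q + d"

text \<open>
  Intervals of vectors are boxes, the order on \<^typ>\<open>real^'n\<close> being componentwise; the distance on
  pairs of vectors is the Euclidean one.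
\<close>

definition fes ::
  "real^'n^'n \<Rightarrow> real^'n \<Rightarrow> real^'n \<Rightarrow> real^'n \<Rightarrow> real^'n \<Rightarrow> real^'n \<Rightarrow> real^'n::finite \<Rightarrow> real" where
  "fes A d vmin vmax qmin qmax q = infdist (q, voltage A d q) ({qmin..qmax} \<times> {vmin..vmax})"

definition proj_nonneg :: "real^'n \<Rightarrow> real^'n::finite" where
  "proj_nonneg y = closest_point {z. 0 \<le> z} y"

text \<open>The parameter \<open>s\<close> is the value chosen for the sign of \<open>0\<close>.\<close>

definition sign_vec :: "real \<Rightarrow> real^'n \<Rightarrow> real^'n::finite" where
  "sign_vec s y = (\<chi> i. if y $ i = 0 then s else sgn (y $ i))"

definition vclb_run ::
  "real^'n^'n \<Rightarrow> real^'n \<Rightarrow> real^'n \<Rightarrow> real^'n \<Rightarrow> real^'n \<Rightarrow> real^'n \<Rightarrow> real \<Rightarrow> real \<Rightarrow> real \<Rightarrow>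
   (nat \<Rightarrow> real^'n) \<Rightarrow> (nat \<Rightarrow> real^'n) \<Rightarrow> (nat \<Rightarrow> real^'n) \<Rightarrow> (nat \<Rightarrow> real^'n) \<Rightarrow>
   (nat \<Rightarrow> real^'n::finite) \<Rightarrow> bool" where
  "vclb_run A d vmin vmax qmin qmax s \<alpha> \<beta> lmin lmax mmin mmax q \<longleftrightarrow>
     lmin 0 = 0 \<and> lmax 0 = 0 \<and> mmin 0 = 0 \<and> mmax 0 = 0 \<and>
     (\<forall>t. q t = lmin t - lmax t + matrix_inv A *v (mmin t - mmax t) \<and>
       lmin (Suc t) = proj_nonneg (lmin t + \<alpha> *\<^sub>R (vmin - voltage A d (q t))) \<and>
       lmax (Suc t) = proj_nonneg (lmax t + \<alpha> *\<^sub>R (voltage A d (q t) - vmax)) \<and>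
       mmin (Suc t) = proj_nonneg (mmin t + \<beta> *\<^sub>R sign_vec s (qmin - q t)) \<and>
       mmax (Suc t) = proj_nonneg (mmax t + \<beta> *\<^sub>R sign_vec s (q t - qmax)))"

end

theory Submission
  imports Defs
begin

text \<open>
  The algorithm is an ascent method for a Lagrangian dual. Consider the auxiliary problem of minimizing
  \<open>(q \<bullet> A q) / 2\<close> subject to the operating limits. Since \<open>A\<close> is positive definite, for given
  multipliers the Lagrangian has exactly one stationary point, its minimizer, and the iterate \<open>q(t)\<close>
  is that point for the current multipliers. The dual function \<open>D\<close> is the value of the Lagrangian there,
  and its gradient consists of the constraint residuals at \<open>q(t)\<close>. So the updates of the voltage multipliers are
  projected gradient steps, and those of the injection multipliers keep only the signs of the gradient.

  The proof follows the growth of \<open>D\<close> along the run. It starts at \<open>D = 0\<close>, and by weak duality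
  (\<open>weak_duality\<close>) it never exceeds the cost of a feasible injection, which is at most
  \<open>\<lambda>\<^sub>m\<^sub>a\<^sub>x(A) N Q / 2\<close>. The gradient of \<open>D\<close> is Lipschitz with constant \<open>L\<close>, because the
  Hessian is governed by \<open>2 (A + A\<inverse>)\<close>, whose largest eigenvalue is \<open>L\<close>
  (\<open>inverse_spectrum_bound\<close>, \<open>dual_ascent\<close>). Hence a step of length \<open>1 / L\<close> on the voltage
  multipliers gains the squared voltage violation over \<open>2 L\<close> (\<open>gradient_step_gain\<close>). A sign
  step on the injection multipliers gains \<open>\<beta>\<close> times the injection violation, up to an error of order
  \<open>L N \<beta>\<^sup>2\<close> (\<open>sign_step_gain\<close>). For the given \<open>\<beta>\<close> the error is at most a quarter of the gain as
  long as the feasibility measure exceeds \<open>\<epsilon>\<close>, so each such step raises \<open>D\<close> by at least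
  \<open>3 \<epsilon>\<^sup>2 / (16 N\<^sup>3\<^sup>/\<^sup>2 L)\<close> (\<open>progress_while_infeasible\<close>). An infeasible run longer than the claimed bound
  would therefore push \<open>D\<close> past its ceiling.

  The tree enters only through positive definiteness of \<open>A\<close> (\<open>sens_matrix_pos_def\<close>).
\<close>

section \<open>Extremal eigenvalues of symmetric matrices\<close>

definition pos_def :: "real^'n^'n::finite \<Rightarrow> bool" where
  "pos_def A \<longleftrightarrow> transpose A = A \<and> (\<forall>w. w \<noteq> 0 \<longrightarrow> 0 < w \<bullet> (A *v w))"

lemma inner_symmetric_matrix:
  fixes A :: "real^'n^'n"
  assumes "transpose A = A"
  shows "(A *v u) \<bullet> w = u \<bullet> (A *v w)"
  by (metis assms dot_lmul_matrix vector_transpose_matrix)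

text \<open>
  A maximizer \<open>w\<close> of the form on the unit sphere, with value \<open>l\<close>, makes the semidefinite form of
  \<open>l I - C\<close> vanish. Perturbing \<open>w\<close> in the direction of the residual \<open>r = l w - C w\<close> would make this
  form negative unless \<open>r = 0\<close>.
\<close>

lemma top_eigenpair:
  fixes C :: "real^'n^'n"
  assumes sym: "transpose C = C"
  obtains l w where "w \<noteq> 0" "C *v w = l *\<^sub>R w" "\<And>y. y \<bullet> (C *v y) \<le> l * (y \<bullet> y)"
proof -
  let ?S = "sphere (0 :: real^'n) 1"
  have "compact ?S" "?S \<noteq> {}"
    using vector_choose_size[of 1] by auto
  moreover have "continuous_on ?S (\<lambda>y. y \<bullet> (C *v y))"
    by (intro continuous_intros matrix_vector_mult_linear_continuous_on)
  ultimately obtain w where w: "w \<in> ?S" and max: "\<And>y. y \<in> ?S \<Longrightarrow> y \<bullet> (C *v y) \<le> w \<bullet> (C *v w)"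
    using continuous_attains_sup[of ?S "\<lambda>y. y \<bullet> (C *v y)"] by blast
  define l where "l = w \<bullet> (C *v w)"
  have ww: "w \<bullet> w = 1" and "w \<noteq> 0"
    using w by (auto simp: dot_square_norm)
  have bound: "y \<bullet> (C *v y) \<le> l * (y \<bullet> y)" for y
  proof (cases "y = 0")
    case False
    have "(y /\<^sub>R norm y) \<bullet> (C *v (y /\<^sub>R norm y)) \<le> l"
      using False max[of "y /\<^sub>R norm y"] by (simp add: l_def)
    then have "(y \<bullet> (C *v y)) / (norm y)\<^sup>2 \<le> l"
      by (simp add: matrix_vector_mult_scaleR divide_inverse power2_eq_square mult_ac)
    then show ?thesis
      using False by (simp add: dot_square_norm pos_divide_le_eq)
  qed simp
  define r where "r = l *\<^sub>R w - C *v w"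
  define c where "c = l * (r \<bullet> r) - r \<bullet> (C *v r)"
  have wr: "l * (w \<bullet> r) - w \<bullet> (C *v r) = r \<bullet> r"
  proof -
    have "r \<bullet> r = (l *\<^sub>R w - C *v w) \<bullet> r" by (simp only: r_def)
    then show ?thesis by (simp add: inner_diff_left inner_symmetric_matrix[OF sym])
  qed
  have poly: "0 \<le> 2 * t * (r \<bullet> r) + t\<^sup>2 * c" for t
  proof -
    let ?y = "w + t *\<^sub>R r"
    have rw: "r \<bullet> (C *v w) = w \<bullet> (C *v r)"
      using inner_symmetric_matrix[OF sym, of r w] by (simp add: inner_commute)
    have "?y \<bullet> (C *v ?y) = l + 2 * t * (w \<bullet> (C *v r)) + t\<^sup>2 * (r \<bullet> (C *v r))"
      by (simp add: matrix_vector_right_distrib matrix_vector_mult_scaleR inner_add_left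
          inner_add_right rw l_def[symmetric] power2_eq_square distrib_left mult.assoc)
    moreover have "?y \<bullet> ?y = 1 + 2 * t * (w \<bullet> r) + t\<^sup>2 * (r \<bullet> r)"
      by (simp add: inner_add_left inner_add_right ww inner_commute[of r w] power2_eq_square
          distrib_left mult.assoc)
    ultimately have "0 \<le> 2 * t * (l * (w \<bullet> r) - w \<bullet> (C *v r)) + t\<^sup>2 * c"
      using bound[of ?y] by (simp add: c_def algebra_simps)
    then show ?thesis by (simp add: wr)
  qed
  have "r \<bullet> r = 0"
  proof (rule ccontr)
    assume "r \<bullet> r \<noteq> 0"
    then have pos: "0 < r \<bullet> r" by (metis inner_ge_zero less_eq_real_def)
    \<comment> \<open>small enough for the linear term of the parabola at \<open>- t\<close> to dominate the quadratic one\<close>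
    define t where "t = (r \<bullet> r) / (\<bar>c\<bar> + 1)"
    have t: "0 < t" using pos by (simp add: t_def divide_pos_pos)
    have "t * c \<le> t * (\<bar>c\<bar> + 1)" using t by (intro mult_left_mono) auto
    also have "\<dots> = r \<bullet> r" by (simp add: t_def add_nonneg_eq_0_iff)
    finally have "- 2 * (r \<bullet> r) + t * c < 0" using pos by linarith
    with t have "t * (- 2 * (r \<bullet> r) + t * c) < 0" by (rule mult_pos_neg)
    then show False using poly[of "- t"] by (simp add: power2_eq_square algebra_simps)
  qed
  then have "C *v w = l *\<^sub>R w" by (simp add: r_def)
  then show thesis using that \<open>w \<noteq> 0\<close> bound by blast
qed

text \<open>
  Eigenvectors of a symmetric matrix for distinct eigenvalues are orthogonal, hence independent. Finiteness
  is what gives the maxima in the definitions of \<open>lambda_max\<close> and of the step size their meaning.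
\<close>

lemma finite_eigenvals:
  fixes A :: "real^'n^'n"
  assumes sym: "transpose A = A"
  shows "finite (eigenvals A)"
proof -
  define v where "v l = (SOME w. w \<noteq> 0 \<and> A *v w = l *\<^sub>R w)" for l
  have v: "v l \<noteq> 0" "A *v v l = l *\<^sub>R v l" if "l \<in> eigenvals A" for l
  proof -
    have "\<exists>w. w \<noteq> 0 \<and> A *v w = l *\<^sub>R w" using that by (simp add: eigenvals_def)
    then have "v l \<noteq> 0 \<and> A *v v l = l *\<^sub>R v l" unfolding v_def by (rule someI_ex)
    then show "v l \<noteq> 0" "A *v v l = l *\<^sub>R v l" by auto
  qed
  have orth: "v l \<bullet> v k = 0" if "l \<in> eigenvals A" "k \<in> eigenvals A" "l \<noteq> k" for l k
    using inner_symmetric_matrix[OF sym, of "v l" "v k"] v[OF that(1)] v[OF that(2)] that(3) by simp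
  have inj: "inj_on v (eigenvals A)"
    using orth v by (metis inj_onI inner_eq_zero_iff)
  have "pairwise orthogonal (v ` eigenvals A)"
    using orth by (auto simp: pairwise_def orthogonal_def)
  moreover have "0 \<notin> v ` eigenvals A" using v by auto
  ultimately have "finite (v ` eigenvals A)"
    using pairwise_orthogonal_independent independent_imp_finite by blast
  then show ?thesis using inj finite_imageD by blast
qed

lemma eigenvals_pos:
  assumes "pos_def A" "l \<in> eigenvals A"
  shows "0 < l"
proof -
  obtain w where "w \<noteq> 0" "A *v w = l *\<^sub>R w"
    using assms(2) by (auto simp: eigenvals_def)
  then show ?thesis
    using assms(1) by (metis pos_def_def inner_scaleR_right inner_gt_zero_iff zero_less_mult_pos2)
qed

lemma quadratic_form_le_lambda_max:
  assumes "pos_def A"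
  shows "y \<bullet> (A *v y) \<le> lambda_max A * (y \<bullet> y)"
proof -
  have sym: "transpose A = A" using assms by (simp add: pos_def_def)
  obtain l w where "w \<noteq> 0" "A *v w = l *\<^sub>R w" and le: "y \<bullet> (A *v y) \<le> l * (y \<bullet> y)"
    using top_eigenpair[OF sym] by metis
  then have "l \<in> eigenvals A" by (auto simp: eigenvals_def)
  then have "l \<le> lambda_max A"
    using finite_eigenvals[OF sym] unfolding lambda_max_def
    by (intro Max_ge_iff[THEN iffD2]) force+
  then show ?thesis using le by (meson inner_ge_zero mult_right_mono order_trans)
qed

lemma lambda_max_nonneg:
  assumes "pos_def (A :: real^'n^'n::finite)"
  shows "0 \<le> lambda_max A"
proof -
  obtain y :: "real^'n" where "norm y = 1" using vector_choose_size[of 1] by auto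
  then show ?thesis
    using quadratic_form_le_lambda_max[OF assms, of y] assms
    by (simp add: dot_square_norm pos_def_def) (metis less_eq_real_def norm_zero order_trans zero_neq_one)
qed

text \<open>
  In terms of \<open>z = A\<^sup>1\<^sup>/\<^sup>2 y\<close> the second claim says that \<open>A + A\<inverse>\<close> is bounded by \<open>L / 2\<close>, that is, that
  \<open>C = A\<^sup>2 - (L / 2) A + I\<close> is negative semidefinite; in this form it needs no square root of \<open>A\<close>. If
  \<open>C\<close> had an eigenvalue \<open>n > 0\<close>, then factoring the quadratic \<open>k\<^sup>2 - (L / 2) k + 1 - n\<close>, whose roots are real
  because \<open>L \<ge> 4\<close>, would exhibit one of the roots as an eigenvalue of \<open>A\<close>; but every eigenvalue
  \<open>k\<close> of \<open>A\<close> satisfies \<open>k\<^sup>2 - (L / 2) k + 1 \<le> 0\<close>.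
\<close>

lemma inverse_spectrum_bound:
  assumes A: "pos_def A" and L: "L = (MAX l\<in>eigenvals A. 2 * (l + 1 / l))"
  shows "4 \<le> L" and "(A *v y) \<bullet> (A *v y) + y \<bullet> y \<le> L / 2 * (y \<bullet> (A *v y))"
proof -
  have sym: "transpose A = A" using A by (simp add: pos_def_def)
  have ge: "2 * (l + 1 / l) \<le> L" if "l \<in> eigenvals A" for l
    unfolding L using finite_eigenvals[OF sym] that by (intro Max_ge) auto
  obtain l0 where l0: "l0 \<in> eigenvals A"
    using top_eigenpair[OF sym] by (metis (mono_tags, lifting) eigenvals_def mem_Collect_eq)
  have "0 < l0" using A l0 by (rule eigenvals_pos)
  then have "2 \<le> l0 + 1 / l0"
    using sum_squares_ge_zero[of "l0 - 1" 0] by (simp add: field_simps)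
  then show L4: "4 \<le> L" using ge[OF l0] by simp
  define C where "C = A ** A - (L / 2) *\<^sub>R A + mat 1"
  have C: "C *v w = A *v (A *v w) - (L / 2) *\<^sub>R (A *v w) + w" for w
    by (simp add: C_def algebra_simps matrix_vector_mul_assoc scaleR_matrix_vector_assoc)
  have "transpose C = C"
    using sym by (simp add: C_def transpose_def vec_eq_iff matrix_matrix_mult_def mat_def mult.commute)
  then obtain n w where w: "w \<noteq> 0" "C *v w = n *\<^sub>R w" and le: "\<And>y. y \<bullet> (C *v y) \<le> n * (y \<bullet> y)"
    by (rule top_eigenpair) blast
  have "n \<le> 0"
  proof (rule ccontr)
    assume "\<not> n \<le> 0"
    then have n: "0 < n" by simp
    define s where "s = sqrt ((L / 2)\<^sup>2 - 4 * (1 - n))"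
    have "2\<^sup>2 \<le> (L / 2)\<^sup>2" using L4 by (intro power_mono) auto
    then have s: "s\<^sup>2 = (L / 2)\<^sup>2 - 4 * (1 - n)" using n by (simp add: s_def)
    define l m where "l = (L / 2 + s) / 2" and "m = (L / 2 - s) / 2"
    have lm: "l + m = L / 2" "l * m = 1 - n"
      using s by (auto simp: l_def m_def field_simps power2_eq_square)
    have not_eigen: "k \<notin> eigenvals A" if "k * (L / 2 - k) = 1 - n" for k
    proof
      assume k: "k \<in> eigenvals A"
      then have "0 < k" using A eigenvals_pos by blast
      then have "k * k + 1 \<le> L / 2 * k" using ge[OF k] by (simp add: field_simps)
      then show False using that n by (simp add: algebra_simps)
    qed
    \<comment> \<open>\<open>(A - l) (A - m) w = 0\<close>, so either \<open>w\<close> is an eigenvector for \<open>m\<close> or \<open>w'\<close> is one for \<open>l\<close>\<close>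
    define w' where "w' = A *v w - m *\<^sub>R w"
    have "A *v (A *v w) = (l + m) *\<^sub>R (A *v w) - (l * m) *\<^sub>R w"
      using w(2) C[of w] unfolding lm by (simp add: algebra_simps)
    then have "A *v w' = l *\<^sub>R w'"
      by (simp add: w'_def algebra_simps matrix_vector_mult_diff_distrib matrix_vector_mult_scaleR)
    moreover have "l \<notin> eigenvals A" "m \<notin> eigenvals A"
      using lm by (auto intro!: not_eigen simp: algebra_simps lm(1)[symmetric])
    ultimately have "w' = 0" "A *v w \<noteq> m *\<^sub>R w" using w(1) by (auto simp: eigenvals_def)
    then show False by (simp add: w'_def)
  qed
  then have "y \<bullet> (C *v y) \<le> 0"
    using le[of y] by (meson inner_ge_zero mult_nonpos_nonneg order_trans)
  then show "(A *v y) \<bullet> (A *v y) + y \<bullet> y \<le> L / 2 * (y \<bullet> (A *v y))"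
    using inner_symmetric_matrix[OF sym, of y "A *v y"]
    by (simp add: C algebra_simps)
qed

lemma matrix_inv_vector:
  assumes "pos_def A"
  shows "A *v (matrix_inv A *v y) = y"
proof -
  have "\<exists>B. B ** A = mat 1"
    unfolding matrix_left_invertible_ker using assms
    by (metis pos_def_def inner_zero_right less_irrefl)
  then have "invertible A" by (simp add: invertible_left_inverse)
  then have "A ** matrix_inv A = mat 1"
    unfolding matrix_inv_def invertible_def by (rule someI2_ex) blast
  then show ?thesis by (simp add: matrix_vector_mul_assoc)
qed

section \<open>The sensitivity matrix\<close>

context
  fixes E :: "('n::finite option \<times> 'n option) set"
  assumes tree: "rooted_tree E"
begin

interpretation wf_digraph "network E"
  by standard (auto simp: network_def)

lemma network_simps [simp]:
  "verts (network E) = UNIV" "arcs (network E) = E" "tail (network E) = fst" "head (network E) = snd"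
  by (auto simp: network_def)

text \<open>
  Walks from the root are determined from their end backwards: no edge enters the root, and exactly one
  edge enters any other vertex.
\<close>

lemma awalk_from_root_unique:
  "awalk None p v \<Longrightarrow> awalk None p' v \<Longrightarrow> p = p'"
proof (induction p arbitrary: p' v rule: rev_induct)
  case Nil
  then have "v = None" by (simp add: awalk_Nil_iff)
  with Nil(2) show ?case using tree
    by (cases p' rule: rev_cases) (auto simp: rooted_tree_def awalk_Cons_iff awalk_Nil_iff)
next
  case (snoc e p)
  then have e: "e \<in> E" "snd e = v" "awalk None p (fst e)"
    by (auto simp: awalk_Cons_iff awalk_Nil_iff)
  then obtain i where i: "v = Some i"
    using tree by (cases v; cases e) (auto simp: rooted_tree_def)
  then obtain p'' e' where p': "p' = p'' @ [e']"
    using snoc.prems(2) by (cases p' rule: rev_cases) (auto simp: awalk_Nil_iff)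
  with snoc.prems(2) have e': "e' \<in> E" "snd e' = v" "awalk None p'' (fst e')"
    by (auto simp: awalk_Cons_iff awalk_Nil_iff)
  have "e = e'"
    using tree e(1,2) e'(1,2) i unfolding rooted_tree_def by (metis prod.collapse)
  with snoc.IH e(3) e'(3) p' show ?case by blast
qed

text \<open>
  The quadratic form is \<open>2 (\<Sum>e\<in>E. x e * (S w e)\<^sup>2)\<close>, where \<open>S w e\<close> sums \<open>w\<close> over the buses
  downstream of \<open>e\<close>. For \<open>w \<noteq> 0\<close> one square is positive: take a bus \<open>i\<close> farthest from the root
  among those with \<open>w $ i \<noteq> 0\<close>, and the edge \<open>e\<close> entering it. All other buses downstream of \<open>e\<close> lie
  farther from the root, so \<open>S w e = w $ i\<close>.
\<close>

lemma sens_matrix_pos_def: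
  assumes x: "\<And>e. e \<in> E \<Longrightarrow> 0 < x e"
  shows "pos_def (sens_matrix E x)"
proof -
  have "\<exists>p. apath None p (Some i)" for i
    using tree reachable_apath unfolding rooted_tree_def by blast
  then obtain path where path: "\<And>i. apath None (path i) (Some i)" by metis
  then have awalk: "awalk None (path i) (Some i)" for i by (rule awalkI_apath)
  have path_edges: "path_edges E i = set (path i)" for i
    using path awalk awalk_from_root_unique awalkI_apath unfolding path_edges_def by blast
  have sub: "set (path i) \<subseteq> E" for i using awalk[of i] by (simp add: awalk_def)
  define S where "S w e = (\<Sum>i | e \<in> set (path i). w $ i)" for w :: "real^'n" and e
  have form: "w \<bullet> (sens_matrix E x *v w) = 2 * (\<Sum>e\<in>E. x e * (S w e)\<^sup>2)" for w
  proof -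
    have entry: "sens_matrix E x $ i $ j
        = 2 * (\<Sum>e\<in>E. x e * of_bool (e \<in> set (path i)) * of_bool (e \<in> set (path j)))" for i j
    proof -
      have "(\<Sum>e\<in>set (path i) \<inter> set (path j). x e)
          = (\<Sum>e\<in>E. x e * of_bool (e \<in> set (path i)) * of_bool (e \<in> set (path j)))"
        using sub by (intro sum.mono_neutral_cong_left) auto
      then show ?thesis by (simp add: sens_matrix_def path_edges)
    qed
    have S: "S w e = (\<Sum>i\<in>UNIV. of_bool (e \<in> set (path i)) * w $ i)" for e
      unfolding S_def by (intro sum.mono_neutral_cong_left) auto
    have "w \<bullet> (sens_matrix E x *v w) = (\<Sum>i\<in>UNIV. \<Sum>j\<in>UNIV. \<Sum>e\<in>E.
        2 * (x e * ((of_bool (e \<in> set (path i)) * w $ i) * (of_bool (e \<in> set (path j)) * w $ j))))"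
      by (simp add: inner_vec_def matrix_vector_mult_def entry sum_distrib_left sum_distrib_right mult_ac)
    also have "\<dots> = (\<Sum>i\<in>UNIV. \<Sum>e\<in>E. \<Sum>j\<in>UNIV.
        2 * (x e * ((of_bool (e \<in> set (path i)) * w $ i) * (of_bool (e \<in> set (path j)) * w $ j))))"
      by (intro sum.cong sum.swap) auto
    also have "\<dots> = (\<Sum>e\<in>E. \<Sum>i\<in>UNIV. \<Sum>j\<in>UNIV.
        2 * (x e * ((of_bool (e \<in> set (path i)) * w $ i) * (of_bool (e \<in> set (path j)) * w $ j))))"
      by (rule sum.swap)
    also have "\<dots> = 2 * (\<Sum>e\<in>E. x e * (S w e)\<^sup>2)"
      unfolding S power2_eq_square sum_product by (simp only: sum_distrib_left)
    finally show ?thesis .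
  qed
  have pos: "0 < w \<bullet> (sens_matrix E x *v w)" if "w \<noteq> 0" for w
  proof -
    have "\<exists>i. w $ i \<noteq> 0" using that by (simp add: vec_eq_iff)
    then obtain i where wi: "w $ i \<noteq> 0"
      and far: "\<And>j. w $ j \<noteq> 0 \<Longrightarrow> length (path j) \<le> length (path i)"
      using ex_has_greatest_nat[of "\<lambda>i. w $ i \<noteq> 0" _ "\<lambda>i. length (path i)"
          "Max (range (\<lambda>i. length (path i))) + 1"]
      by (metis (mono_tags, lifting) Max_ge finite finite_imageI le_imp_less_Suc rangeI Suc_eq_plus1 less_or_eq_imp_le)
    obtain p e where pe: "path i = p @ [e]"
      using awalk[of i] by (cases "path i" rule: rev_cases) (auto simp: awalk_Nil_iff)
    have snd_e: "snd e = Some i"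
      using awalk[of i] by (auto simp: pe awalk_Cons_iff awalk_Nil_iff)
    have zero: "w $ j = 0" if j: "e \<in> set (path j)" "j \<noteq> i" for j
    proof (rule ccontr)
      assume "w $ j \<noteq> 0"
      obtain p1 p2 where split: "path j = p1 @ e # p2" using j(1) by (meson split_list)
      have w1: "awalk None (p1 @ [e]) (Some i)" "awalk (Some i) p2 (Some j)"
        using awalk[of j] snd_e by (auto simp: split awalk_Cons_iff awalk_Nil_iff)
      then have "path i = p1 @ [e]" using awalk awalk_from_root_unique by blast
      moreover have "p2 \<noteq> []" using w1(2) j(2) by (auto simp: awalk_Nil_iff)
      ultimately have "length (path i) < length (path j)" by (simp add: split)
      then show False using far[OF \<open>w $ j \<noteq> 0\<close>] by simp
    qed
    have "S w e = (\<Sum>j\<in>{i}. w $ j)"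
      unfolding S_def using zero pe by (intro sum.mono_neutral_right) auto
    then have "0 < x e * (S w e)\<^sup>2" using wi x sub[of i] pe by auto
    moreover have "e \<in> E" using sub[of i] pe by auto
    ultimately have "0 < (\<Sum>e\<in>E. x e * (S w e)\<^sup>2)"
      using x by (intro sum_pos2[of E e] mult_nonneg_nonneg) (auto intro: less_imp_le)
    then show ?thesis by (simp add: form)
  qed
  have "transpose (sens_matrix E x) = sens_matrix E x"
    by (simp add: sens_matrix_def transpose_def vec_eq_iff Int_commute)
  with pos show ?thesis by (simp add: pos_def_def)
qed

end

section \<open>Projections and the feasibility measure\<close>

lemma proj_nonneg_nth: "proj_nonneg y $ i = max (y $ i) 0"
proof -
  have "(\<chi> i. max (y $ i) 0) = closest_point {z. 0 \<le> z} y"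
  proof (rule closest_point_unique)
    show "convex {z :: real^'a. 0 \<le> z}"
      by (auto simp: convex_def less_eq_vec_def)
    have "closed (\<Inter>i. {z :: real^'a. 0 \<le> z $ i})"
      by (intro closed_INT ballI closed_Collect_le continuous_intros)
    moreover have "(\<Inter>i. {z :: real^'a. 0 \<le> z $ i}) = {z. 0 \<le> z}"
      by (auto simp: less_eq_vec_def)
    ultimately show "closed {z :: real^'a. 0 \<le> z}" by simp
    show "\<forall>z\<in>{z. 0 \<le> z}. dist y (\<chi> i. max (y $ i) 0) \<le> dist y z"
      by (auto simp: dist_vec_def dist_real_def less_eq_vec_def intro!: L2_set_mono)
        (smt (verit))
  qed (simp add: less_eq_vec_def)
  then show ?thesis by (simp add: proj_nonneg_def vec_eq_iff)
qed

lemma proj_nonneg_ge_0: "0 \<le> proj_nonneg y"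
  by (simp add: less_eq_vec_def proj_nonneg_nth)

text \<open>
  The point is \<open>y\<close> clamped to the box. At most one of the two bounds is violated in each coordinate, so the two
  corrections are orthogonal.
\<close>

lemma box_point_at_distance:
  fixes a b y :: "real^'n::finite"
  assumes "a \<le> b"
  obtains c where "c \<in> {a..b}"
    "(dist y c)\<^sup>2 = (norm (proj_nonneg (a - y)))\<^sup>2 + (norm (proj_nonneg (y - b)))\<^sup>2"
proof
  let ?c = "y + proj_nonneg (a - y) - proj_nonneg (y - b)"
  have ab: "a $ i \<le> b $ i" for i using assms by (simp add: less_eq_vec_def)
  show "?c \<in> {a..b}"
    using ab by (auto simp: less_eq_vec_def proj_nonneg_nth max_def) (smt (verit))+
  have "proj_nonneg (a - y) \<bullet> proj_nonneg (y - b) = 0"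
    unfolding inner_vec_def using ab
    by (intro sum.neutral) (auto simp: proj_nonneg_nth max_def, smt (verit))
  moreover have "y - ?c = proj_nonneg (y - b) - proj_nonneg (a - y)" by simp
  ultimately show "(dist y ?c)\<^sup>2
      = (norm (proj_nonneg (a - y)))\<^sup>2 + (norm (proj_nonneg (y - b)))\<^sup>2"
    by (simp only: dist_norm power2_norm_eq_inner) (simp add: algebra_simps inner_commute)
qed

lemma fes_le_violations:
  assumes "qmin \<le> qmax" "vmin \<le> vmax"
  shows "(fes A d vmin vmax qmin qmax q)\<^sup>2 \<le>
    (norm (proj_nonneg (vmin - voltage A d q)))\<^sup>2 + (norm (proj_nonneg (voltage A d q - vmax)))\<^sup>2
    + (norm (proj_nonneg (qmin - q)))\<^sup>2 + (norm (proj_nonneg (q - qmax)))\<^sup>2"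
proof -
  obtain c where c: "c \<in> {qmin..qmax}"
    "(dist q c)\<^sup>2 = (norm (proj_nonneg (qmin - q)))\<^sup>2 + (norm (proj_nonneg (q - qmax)))\<^sup>2"
    using box_point_at_distance[OF assms(1)] .
  obtain u where u: "u \<in> {vmin..vmax}"
    "(dist (voltage A d q) u)\<^sup>2 = (norm (proj_nonneg (vmin - voltage A d q)))\<^sup>2
      + (norm (proj_nonneg (voltage A d q - vmax)))\<^sup>2"
    using box_point_at_distance[OF assms(2)] .
  have "fes A d vmin vmax qmin qmax q \<le> dist (q, voltage A d q) (c, u)"
    unfolding fes_def using c(1) u(1) by (intro infdist_le) auto
  then have "(fes A d vmin vmax qmin qmax q)\<^sup>2 \<le> (dist (q, voltage A d q) (c, u))\<^sup>2"
    by (intro power_mono) (auto simp: fes_def infdist_nonneg)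
  also have "\<dots> = (dist q c)\<^sup>2 + (dist (voltage A d q) u)\<^sup>2"
    by (simp add: dist_Pair_Pair)
  finally show ?thesis using c(2) u(2) by simp
qed

section \<open>The dual function along the iterates\<close>

text \<open>
  The Lagrangian of minimizing \<open>(q \<bullet> A q) / 2\<close> under the voltage limits (multipliers \<open>a\<close>, \<open>b\<close> for
  the lower and upper ones) and the injection limits (multipliers \<open>m\<close>, \<open>n\<close>).
\<close>

definition lagrangian ::
  "real^'n^'n \<Rightarrow> real^'n \<Rightarrow> real^'n \<Rightarrow> real^'n \<Rightarrow> real^'n \<Rightarrow> real^'n \<Rightarrow>
   real^'n \<Rightarrow> real^'n \<Rightarrow> real^'n \<Rightarrow> real^'n \<Rightarrow> real^'n::finite \<Rightarrow> real" where
  "lagrangian A d vmin vmax qmin qmax a b m n q =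
     (q \<bullet> (A *v q)) / 2 + a \<bullet> (vmin - voltage A d q) + b \<bullet> (voltage A d q - vmax)
     + m \<bullet> (qmin - q) + n \<bullet> (q - qmax)"

text \<open>
  The assumption \<open>stat\<close> says that the gradient of the Lagrangian in \<open>q\<close> vanishes, and the Lagrangian is
  quadratic in \<open>q\<close>. The identity serves twice: for weak duality, with a feasible point as \<open>q'\<close>, and for the
  change of the dual function between consecutive iterates.
\<close>

lemma lagrangian_around_stationary_point:
  assumes sym: "transpose A = A" and stat: "A *v q = A *v (a - b) + (m - n)"
  shows "lagrangian A d vmin vmax qmin qmax a b m n q' =
    lagrangian A d vmin vmax qmin qmax a b m n q + ((q' - q) \<bullet> (A *v (q' - q))) / 2"
proof -
  define z where "z = q' - q"
  have q': "q' = q + z" by (simp add: z_def)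
  have "(A *v q) \<bullet> z = (A *v (a - b) + (m - n)) \<bullet> z" by (simp only: stat)
  then have stat_z: "q \<bullet> (A *v z) = a \<bullet> (A *v z) - b \<bullet> (A *v z) + m \<bullet> z - n \<bullet> z"
    by (simp add: inner_add_left inner_diff_left inner_symmetric_matrix[OF sym])
  have "z \<bullet> (A *v q) = q \<bullet> (A *v z)"
    by (metis inner_commute inner_symmetric_matrix[OF sym])
  then have "q' \<bullet> (A *v q') = q \<bullet> (A *v q) + 2 * (q \<bullet> (A *v z)) + z \<bullet> (A *v z)"
    by (simp add: q' matrix_vector_right_distrib inner_add_left inner_add_right)
  moreover have "voltage A d q' = voltage A d q + A *v z"
    by (simp add: voltage_def q' matrix_vector_right_distrib)
  ultimately have "lagrangian A d vmin vmax qmin qmax a b m n q' =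
      lagrangian A d vmin vmax qmin qmax a b m n q + (z \<bullet> (A *v z)) / 2"
    using stat_z unfolding lagrangian_def
    by (simp add: q' inner_add_right inner_diff_right add_divide_distrib diff_divide_distrib)
  then show ?thesis by (simp only: z_def)
qed

lemma weak_duality:
  fixes A :: "real^'n^'n::finite"
  assumes A: "pos_def A" and stat: "A *v q = A *v (a - b) + (m - n)"
    and nonneg: "0 \<le> a" "0 \<le> b" "0 \<le> m" "0 \<le> n"
    and feasible: "qmin \<le> q'" "q' \<le> qmax" "vmin \<le> voltage A d q'" "voltage A d q' \<le> vmax"
  shows "lagrangian A d vmin vmax qmin qmax a b m n q \<le> (q' \<bullet> (A *v q')) / 2"
proof -
  have sym: "transpose A = A" using A by (simp add: pos_def_def)
  have le0: "y \<bullet> z \<le> 0" if "0 \<le> y" "z \<le> 0" for y z :: "real^'n"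
    unfolding inner_vec_def using that
    by (intro sum_nonpos) (auto simp: less_eq_vec_def mult_nonneg_nonpos)
  have "0 \<le> (q' - q) \<bullet> (A *v (q' - q))"
    using A by (cases "q' - q = 0") (auto simp: pos_def_def less_imp_le)
  then have "lagrangian A d vmin vmax qmin qmax a b m n q
      \<le> lagrangian A d vmin vmax qmin qmax a b m n q'"
    using lagrangian_around_stationary_point[OF sym stat, of d vmin vmax qmin qmax q'] by linarith
  also have "\<dots> \<le> (q' \<bullet> (A *v q')) / 2"
    unfolding lagrangian_def
    using le0[OF nonneg(1), of "vmin - voltage A d q'"] le0[OF nonneg(2), of "voltage A d q' - vmax"]
      le0[OF nonneg(3), of "qmin - q'"] le0[OF nonneg(4), of "q' - qmax"] feasible by simp
  finally show ?thesis .
qed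

text \<open>
  The minimizer \<open>p\<close> responds linearly to a change \<open>(u, r)\<close> of the multiplier differences, and
  \<open>p \<bullet> A p\<close> is the negated second variation of the dual function. It equals
  \<open>u \<bullet> A p + r \<bullet> p\<close>, so Young's inequality bounds it by \<open>k / 2\<close> times the squared size of \<open>(u, r)\<close>
  plus \<open>1 / (2 k)\<close> times the squared size of \<open>(A p, p)\<close>; by \<open>bound\<close> the last term is absorbed.
\<close>

lemma dual_hessian_bound:
  fixes A :: "real^'n^'n::finite"
  assumes sym: "transpose A = A" and "0 < k"
    and bound: "\<And>y. (A *v y) \<bullet> (A *v y) + y \<bullet> y \<le> k * (y \<bullet> (A *v y))"
    and p: "A *v p = A *v u + r"
  shows "p \<bullet> (A *v p) \<le> k * (u \<bullet> u + r \<bullet> r)"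
proof -
  have young: "2 * (y \<bullet> z) \<le> k * (y \<bullet> y) + (z \<bullet> z) / k" for y z :: "real^'n"
  proof -
    have "0 \<le> (k *\<^sub>R y - z) \<bullet> (k *\<^sub>R y - z)" by simp
    then have "2 * k * (y \<bullet> z) \<le> k\<^sup>2 * (y \<bullet> y) + z \<bullet> z"
      by (simp add: inner_diff_left inner_diff_right inner_commute[of z y] power2_eq_square
          algebra_simps)
    then have "2 * k * (y \<bullet> z) / k \<le> (k\<^sup>2 * (y \<bullet> y) + z \<bullet> z) / k"
      using \<open>0 < k\<close> by (intro divide_right_mono) auto
    then show ?thesis using \<open>0 < k\<close> by (simp add: add_divide_distrib power2_eq_square)
  qed
  have "p \<bullet> (A *v p) = u \<bullet> (A *v p) + r \<bullet> p"
    using arg_cong[OF p, of "\<lambda>y. y \<bullet> p"] inner_symmetric_matrix[OF sym]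
    by (simp add: inner_add_left)
  then have "2 * (p \<bullet> (A *v p)) \<le> k * (u \<bullet> u + r \<bullet> r) + ((A *v p) \<bullet> (A *v p) + p \<bullet> p) / k"
    using young[of u "A *v p"] young[of r p] by (simp add: distrib_left add_divide_distrib)
  also have "((A *v p) \<bullet> (A *v p) + p \<bullet> p) / k \<le> p \<bullet> (A *v p)"
    using bound[of p] \<open>0 < k\<close> by (simp add: field_simps)
  finally show ?thesis by simp
qed

text \<open>
  The descent lemma for the negated dual function: its first-order change, minus \<open>L / 2\<close> times the
  squared step, bounds the increase from below. The contributions of the four multiplier blocks are kept apart
  because two kinds of steps are taken. The factor 2 lost in passing from the differences
  \<open>a - b\<close> and \<open>m - n\<close> to the blocks accounts for the factor 2 in \<open>L\<close>.
\<close>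

lemma dual_ascent:
  fixes A :: "real^'n^'n::finite"
  assumes A: "pos_def A" and L: "L = (MAX l\<in>eigenvals A. 2 * (l + 1 / l))"
    and stat: "A *v q = A *v (a - b) + (m - n)" "A *v q' = A *v (a' - b') + (m' - n')"
  shows "lagrangian A d vmin vmax qmin qmax a b m n q
      + ((a' - a) \<bullet> (vmin - voltage A d q) - L / 2 * (norm (a' - a))\<^sup>2)
      + ((b' - b) \<bullet> (voltage A d q - vmax) - L / 2 * (norm (b' - b))\<^sup>2)
      + ((m' - m) \<bullet> (qmin - q) - L / 2 * (norm (m' - m))\<^sup>2)
      + ((n' - n) \<bullet> (q - qmax) - L / 2 * (norm (n' - n))\<^sup>2)
    \<le> lagrangian A d vmin vmax qmin qmax a' b' m' n' q'"
proof -
  have sym: "transpose A = A" using A by (simp add: pos_def_def)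
  have "0 < L / 2" using inverse_spectrum_bound(1)[OF A L] by simp
  define u r where "u = (a' - a) - (b' - b)" and "r = (m' - m) - (n' - n)"
  have "A *v (q' - q) = A *v u + r"
    by (simp add: stat u_def r_def matrix_vector_mult_diff_distrib)
  then have "(q' - q) \<bullet> (A *v (q' - q)) \<le> L / 2 * (u \<bullet> u + r \<bullet> r)"
    using dual_hessian_bound[OF sym \<open>0 < L / 2\<close>] inverse_spectrum_bound(2)[OF A L] by blast
  moreover have diff: "(y - z) \<bullet> (y - z) \<le> 2 * ((norm y)\<^sup>2 + (norm z)\<^sup>2)" for y z :: "real^'n"
  proof -
    have "0 \<le> (y + z) \<bullet> (y + z)" by simp
    then show ?thesis by (simp add: power2_norm_eq_inner inner_add_left inner_add_right
        inner_diff_left inner_diff_right inner_commute[of z y])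
  qed
  have "u \<bullet> u + r \<bullet> r \<le> 2 * ((norm (a' - a))\<^sup>2 + (norm (b' - b))\<^sup>2
      + (norm (m' - m))\<^sup>2 + (norm (n' - n))\<^sup>2)"
    using diff[of "a' - a" "b' - b"] diff[of "m' - m" "n' - n"] by (simp add: u_def r_def)
  then have "L / 2 * (u \<bullet> u + r \<bullet> r) \<le> L / 2 * (2 * ((norm (a' - a))\<^sup>2 + (norm (b' - b))\<^sup>2
      + (norm (m' - m))\<^sup>2 + (norm (n' - n))\<^sup>2))"
    using \<open>0 < L / 2\<close> by (intro mult_left_mono) auto
  ultimately have quad: "((q' - q) \<bullet> (A *v (q' - q))) / 2
      \<le> L / 2 * ((norm (a' - a))\<^sup>2 + (norm (b' - b))\<^sup>2 + (norm (m' - m))\<^sup>2 + (norm (n' - n))\<^sup>2)"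
    by (simp only: distrib_left)
  have eq: "lagrangian A d vmin vmax qmin qmax a' b' m' n' q' + ((q' - q) \<bullet> (A *v (q' - q))) / 2
      = lagrangian A d vmin vmax qmin qmax a' b' m' n' q"
    unfolding lagrangian_around_stationary_point[OF sym stat(2), of d vmin vmax qmin qmax q]
    by (simp add: matrix_vector_mult_diff_distrib inner_diff_left inner_diff_right)
  have lin: "lagrangian A d vmin vmax qmin qmax a' b' m' n' q = lagrangian A d vmin vmax qmin qmax a b m n q
      + (a' - a) \<bullet> (vmin - voltage A d q) + (b' - b) \<bullet> (voltage A d q - vmax)
      + (m' - m) \<bullet> (qmin - q) + (n' - n) \<bullet> (q - qmax)"
    by (simp add: lagrangian_def inner_diff_left)
  show ?thesis using eq lin quad[unfolded distrib_left] by linarith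
qed

lemma norm_square_sum:
  fixes y :: "real^'n::finite"
  shows "(norm y)\<^sup>2 = (\<Sum>i\<in>UNIV. (y $ i)\<^sup>2)"
  by (simp add: norm_vec_def L2_set_def sum_nonneg)

text \<open>
  Coordinates where the projection is inactive move by \<open>g / L\<close> and gain exactly \<open>g\<^sup>2 / (2 L)\<close>. An active
  projection happens only for \<open>g < 0\<close>, where the left-hand side is zero, and the truncated step still
  does not lose.
\<close>

lemma gradient_step_gain:
  fixes a g :: "real^'n::finite"
  assumes "0 \<le> a" "0 < L"
  defines "a' \<equiv> proj_nonneg (a + (1 / L) *\<^sub>R g)"
  shows "(norm (proj_nonneg g))\<^sup>2 / (2 * L) \<le> (a' - a) \<bullet> g - L / 2 * (norm (a' - a))\<^sup>2"
proof -
  have coord: "(max \<gamma> 0)\<^sup>2 / (2 * L)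
      \<le> (max (\<xi> + \<gamma> / L) 0 - \<xi>) * \<gamma> - L / 2 * (max (\<xi> + \<gamma> / L) 0 - \<xi>)\<^sup>2"
    if "0 \<le> \<xi>" for \<xi> \<gamma> :: real
  proof (cases "0 \<le> \<xi> + \<gamma> / L")
    case True
    then have "max (\<xi> + \<gamma> / L) 0 - \<xi> = \<gamma> / L" by simp
    moreover have "\<gamma> / L * \<gamma> - L / 2 * (\<gamma> / L)\<^sup>2 = \<gamma>\<^sup>2 / (2 * L)"
      using \<open>0 < L\<close> by (simp add: field_simps power2_eq_square)
    moreover have "(max \<gamma> 0)\<^sup>2 / (2 * L) \<le> \<gamma>\<^sup>2 / (2 * L)"
      using \<open>0 < L\<close> by (intro divide_right_mono) (auto simp: max_def)
    ultimately show ?thesis by simp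
  next
    case False
    then have "\<gamma> / L < - \<xi>" by simp
    then have "\<gamma> + L * \<xi> < 0" using \<open>0 < L\<close> by (simp add: field_simps)
    moreover have "0 \<le> L * \<xi>" using that \<open>0 < L\<close> by simp
    ultimately have "\<gamma> < 0" "0 \<le> \<xi> * (- \<gamma> - L / 2 * \<xi>)"
      using that by (auto intro!: mult_nonneg_nonneg)
    then show ?thesis using False by (simp add: algebra_simps power2_eq_square)
  qed
  have "(norm (proj_nonneg g))\<^sup>2 / (2 * L) = (\<Sum>i\<in>UNIV. (max (g $ i) 0)\<^sup>2 / (2 * L))"
    by (simp add: norm_square_sum proj_nonneg_nth sum_divide_distrib)
  also have "\<dots> \<le> (\<Sum>i\<in>UNIV. (a' - a) $ i * g $ i - L / 2 * ((a' - a) $ i)\<^sup>2)"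
    using coord assms(1) by (intro sum_mono) (simp add: a'_def proj_nonneg_nth less_eq_vec_def)
  also have "\<dots> = (a' - a) \<bullet> g - L / 2 * (norm (a' - a))\<^sup>2"
    by (simp add: norm_square_sum inner_vec_def sum_subtractf sum_distrib_left)
  finally show ?thesis .
qed

text \<open>
  The sign step never moves against the gradient, and on violated constraints (\<open>g > 0\<close>) it moves by the full
  length \<open>\<beta>\<close>; so the linear gain is at least \<open>\<beta>\<close> times the 1-norm of the violation, hence \<open>\<beta>\<close> times
  its Euclidean norm. Coordinates with \<open>g = 0\<close> may move by \<open>\<beta>\<close> in either direction, but only the quadratic
  term sees this.
\<close>

lemma sign_step_gain:
  fixes m g :: "real^'n::finite"
    and L \<beta> s :: real
  assumes "0 \<le> m" "0 < L" "0 < \<beta>" and s: "s \<in> {-1, 1}"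
  defines "m' \<equiv> proj_nonneg (m + \<beta> *\<^sub>R sign_vec s g)"
  shows "\<beta> * norm (proj_nonneg g) - L / 2 * (CARD('n) * \<beta>\<^sup>2)
    \<le> (m' - m) \<bullet> g - L / 2 * (norm (m' - m))\<^sup>2"
proof -
  have gain: "\<beta> * max (g $ i) 0 \<le> (m' - m) $ i * g $ i"
    and step: "((m' - m) $ i)\<^sup>2 \<le> \<beta>\<^sup>2" for i
  proof -
    have mi: "0 \<le> m $ i" using assms(1) by (simp add: less_eq_vec_def)
    let ?\<sigma> = "if g $ i = 0 then s else sgn (g $ i)"
    have m'i: "(m' - m) $ i = max (m $ i + \<beta> * ?\<sigma>) 0 - m $ i"
      by (simp add: m'_def proj_nonneg_nth sign_vec_def)
    show "\<beta> * max (g $ i) 0 \<le> (m' - m) $ i * g $ i"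
      unfolding m'i using mi \<open>0 < \<beta>\<close>
      by (auto simp: max_def sgn_if mult_nonpos_nonpos mult_le_0_iff zero_le_mult_iff)
    have "\<bar>max (m $ i + \<beta> * \<sigma>) 0 - m $ i\<bar> \<le> \<bar>\<beta>\<bar>" if "\<sigma> \<in> {-1, 1}" for \<sigma> :: real
      using that mi \<open>0 < \<beta>\<close> by (auto simp: max_def)
    moreover have "?\<sigma> \<in> {-1, 1}" using s by (auto simp: sgn_if)
    ultimately have "\<bar>max (m $ i + \<beta> * ?\<sigma>) 0 - m $ i\<bar> \<le> \<bar>\<beta>\<bar>" by blast
    then show "((m' - m) $ i)\<^sup>2 \<le> \<beta>\<^sup>2" unfolding m'i by (simp only: abs_le_square_iff)
  qed
  have "norm (proj_nonneg g) \<le> (\<Sum>i\<in>UNIV. max (g $ i) 0)"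
    using norm_le_l1_cart[of "proj_nonneg g"] by (simp add: proj_nonneg_nth)
  then have "\<beta> * norm (proj_nonneg g) \<le> (\<Sum>i\<in>UNIV. \<beta> * max (g $ i) 0)"
    using \<open>0 < \<beta>\<close> by (simp add: sum_distrib_left[symmetric])
  also have "\<dots> \<le> (m' - m) \<bullet> g"
    unfolding inner_vec_def using gain by (auto intro: sum_mono)
  finally have "\<beta> * norm (proj_nonneg g) \<le> (m' - m) \<bullet> g" .
  moreover have "(norm (m' - m))\<^sup>2 \<le> CARD('n) * \<beta>\<^sup>2"
  proof -
    have "(norm (m' - m))\<^sup>2 = (\<Sum>i\<in>UNIV. ((m' - m) $ i)\<^sup>2)"
      by (rule norm_square_sum)
    also have "\<dots> \<le> (\<Sum>i\<in>(UNIV :: 'n set). \<beta>\<^sup>2)" by (intro sum_mono step)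
    finally show ?thesis by simp
  qed
  then have "L / 2 * (norm (m' - m))\<^sup>2 \<le> L / 2 * (CARD('n) * \<beta>\<^sup>2)"
    using \<open>0 < L\<close> by (intro mult_left_mono) auto
  ultimately show ?thesis by simp
qed

text \<open>
  Here \<open>a1\<close>, \<open>a2\<close> are the voltage violations and \<open>b1\<close>, \<open>b2\<close> the injection violations, and
  \<open>K\<close> stands for \<open>N\<^sup>3\<^sup>/\<^sup>2\<close>. The gain is quadratic in the former but linear in the latter; below the
  threshold, \<open>B = b1 + b2 \<le> \<epsilon>\<close>, the linear gain \<open>\<epsilon> B\<close> dominates \<open>B\<^sup>2\<close>, and above it
  the linear gain alone is at least \<open>\<epsilon>\<^sup>2\<close>.
\<close>

lemma progress_while_infeasible:
  fixes \<epsilon> L K N :: real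
  assumes "0 < \<epsilon>" "0 < L" "1 \<le> N" "N \<le> K" and \<beta>: "\<beta> = \<epsilon> / (4 * K * L)"
    and nonneg: "0 \<le> b1" "0 \<le> b2" and viol: "\<epsilon>\<^sup>2 \<le> a1\<^sup>2 + a2\<^sup>2 + b1\<^sup>2 + b2\<^sup>2"
  shows "3 * \<epsilon>\<^sup>2 / (16 * K * L)
    \<le> (a1\<^sup>2 / (2 * L) + a2\<^sup>2 / (2 * L)) + (\<beta> * b1 - L / 2 * (N * \<beta>\<^sup>2)) + (\<beta> * b2 - L / 2 * (N * \<beta>\<^sup>2))"
proof -
  define S B where "S = a1\<^sup>2 + a2\<^sup>2" and "B = b1 + b2"
  have "0 \<le> S" "0 \<le> B" using nonneg by (auto simp: S_def B_def)
  have K: "1 \<le> K" using assms by simp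
  have "b1\<^sup>2 + b2\<^sup>2 \<le> B\<^sup>2" using nonneg by (simp add: B_def power2_eq_square algebra_simps)
  then have SB: "\<epsilon>\<^sup>2 \<le> S + B * B" using viol by (simp add: S_def power2_eq_square)
  have "\<epsilon>\<^sup>2 \<le> 2 * K * S + \<epsilon> * B"
  proof (cases "\<epsilon> \<le> B")
    case True
    then have "\<epsilon> * \<epsilon> \<le> \<epsilon> * B" using \<open>0 < \<epsilon>\<close> by (intro mult_left_mono) auto
    moreover have "0 \<le> 2 * K * S" using K \<open>0 \<le> S\<close> by simp
    ultimately show ?thesis by (simp add: power2_eq_square)
  next
    case False
    then have "B * B \<le> \<epsilon> * B" using \<open>0 \<le> B\<close> by (intro mult_right_mono) auto
    moreover have "1 * S \<le> 2 * K * S" using K \<open>0 \<le> S\<close> by (intro mult_right_mono) auto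
    ultimately show ?thesis using SB by simp
  qed
  then have "\<epsilon>\<^sup>2 / (4 * K * L) \<le> (2 * K * S + \<epsilon> * B) / (4 * K * L)"
    using K \<open>0 < L\<close> by (intro divide_right_mono) auto
  also have "\<dots> = S / (2 * L) + \<beta> * B"
    using K \<open>0 < L\<close> by (simp add: \<beta> field_simps)
  finally have gain: "\<epsilon>\<^sup>2 / (4 * K * L) \<le> S / (2 * L) + \<beta> * B" .
  have "L * (N * \<beta>\<^sup>2) = N / K * (\<epsilon>\<^sup>2 / (16 * K * L))"
    using K \<open>0 < L\<close> by (simp add: \<beta> field_simps power2_eq_square)
  also have "\<dots> \<le> 1 * (\<epsilon>\<^sup>2 / (16 * K * L))"
    using assms K by (intro mult_right_mono) auto
  finally have loss: "L * (N * \<beta>\<^sup>2) \<le> \<epsilon>\<^sup>2 / (16 * K * L)" by simp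
  have "3 * \<epsilon>\<^sup>2 / (16 * K * L) = \<epsilon>\<^sup>2 / (4 * K * L) - \<epsilon>\<^sup>2 / (16 * K * L)"
    using K \<open>0 < L\<close> by (simp add: field_simps)
  with gain loss show ?thesis by (simp add: S_def B_def algebra_simps add_divide_distrib)
qed

lemma box_norm_bound:
  fixes lo hi y :: "real^'n::finite"
  assumes "lo \<le> y" "y \<le> hi"
  shows "y \<bullet> y \<le> CARD('n) * Max (range (\<lambda>i. (lo $ i)\<^sup>2) \<union> range (\<lambda>i. (hi $ i)\<^sup>2))"
    (is "_ \<le> _ * ?Q")
proof -
  have "(y $ i)\<^sup>2 \<le> ?Q" for i
  proof -
    have "lo $ i \<le> y $ i" "y $ i \<le> hi $ i" using assms by (auto simp: less_eq_vec_def)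
    then have "\<bar>y $ i\<bar> \<le> \<bar>lo $ i\<bar> \<or> \<bar>y $ i\<bar> \<le> \<bar>hi $ i\<bar>" by linarith
    then have "(y $ i)\<^sup>2 \<le> (lo $ i)\<^sup>2 \<or> (y $ i)\<^sup>2 \<le> (hi $ i)\<^sup>2" by (simp only: abs_le_square_iff)
    moreover have "(lo $ i)\<^sup>2 \<le> ?Q" "(hi $ i)\<^sup>2 \<le> ?Q" by (auto intro!: Max_ge)
    ultimately show ?thesis by linarith
  qed
  then have "(\<Sum>i\<in>UNIV. (y $ i)\<^sup>2) \<le> (\<Sum>i\<in>(UNIV :: 'n set). ?Q)" by (intro sum_mono)
  then show ?thesis by (simp add: inner_vec_def power2_eq_square)
qed

theorem theorem1:
  fixes E :: "('n::finite option \<times> 'n option) set"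
    and x :: "'n option \<times> 'n option \<Rightarrow> real"
    and A :: "real^'n^'n"
    and d vmin vmax qmin qmax :: "real^'n"
    and s \<epsilon> \<alpha> \<beta> L Q :: real
    and lmin lmax mmin mmax q :: "nat \<Rightarrow> real^'n"
  assumes "rooted_tree E"
    and "\<And>e. e \<in> E \<Longrightarrow> 0 < x e"
    and "A = sens_matrix E x"
    and "\<exists>q'. qmin \<le> q' \<and> q' \<le> qmax \<and> vmin \<le> voltage A d q' \<and> voltage A d q' \<le> vmax"
    and "s \<in> {-1, 1}"
    and "0 < \<epsilon>" and "\<epsilon> \<le> 1"
    and "L = (MAX l\<in>eigenvals A. 2 * (l + 1 / l))"
    and "\<alpha> = 1 / L"
    and "\<beta> = \<epsilon> / (4 * real CARD('n) powr (3 / 2) * L)"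
    and "Q = Max (range (\<lambda>i. (qmin $ i)\<^sup>2) \<union> range (\<lambda>i. (qmax $ i)\<^sup>2))"
    and "vclb_run A d vmin vmax qmin qmax s \<alpha> \<beta> lmin lmax mmin mmax q"
  shows "\<exists>T::nat. fes A d vmin vmax qmin qmax (q T) \<le> \<epsilon> \<and>
           int T \<le> \<lceil>16 * real CARD('n) ^ 3 * L * Q * lambda_max A / \<epsilon>\<^sup>2\<rceil>"
proof (rule ccontr)
  let ?bound = "16 * real CARD('n) ^ 3 * L * Q * lambda_max A / \<epsilon>\<^sup>2"
  assume "\<not> ?thesis"
  then have infeasible: "\<epsilon> < fes A d vmin vmax qmin qmax (q t)" if "int t \<le> \<lceil>?bound\<rceil>" for t
    using that by (meson not_le)
  have A: "pos_def A"
    using sens_matrix_pos_def[OF assms(1)] assms(2,3) by blast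
  have L: "0 < L" using inverse_spectrum_bound(1)[OF A assms(8)] by simp
  define N where "N = real CARD('n)"
  define K where "K = N powr (3 / 2)"
  have N: "1 \<le> N" by (simp add: N_def Suc_leI)
  have NK: "N \<le> K" unfolding K_def using N powr_mono[of 1 "3 / 2" N] by simp
  have KN: "K \<le> N\<^sup>2" unfolding K_def using N powr_mono[of "3 / 2" 2 N] by (simp add: powr_numeral)
  have \<beta>: "\<beta> = \<epsilon> / (4 * K * L)" using assms(10) by (simp add: K_def N_def)
  have "0 < \<beta>" using \<beta> \<open>0 < \<epsilon>\<close> L N NK by simp
  obtain q' where q': "qmin \<le> q'" "q' \<le> qmax" "vmin \<le> voltage A d q'" "voltage A d q' \<le> vmax"
    using assms(4) by blast
  note run = assms(12)[unfolded vclb_run_def]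
  define D where "D t = lagrangian A d vmin vmax qmin qmax (lmin t) (lmax t) (mmin t) (mmax t) (q t)" for t
  have nonneg: "0 \<le> lmin t" "0 \<le> lmax t" "0 \<le> mmin t" "0 \<le> mmax t" for t
    using run by (cases t; simp add: proj_nonneg_ge_0)+
  have stat: "A *v q t = A *v (lmin t - lmax t) + (mmin t - mmax t)" for t
    using run by (simp add: matrix_vector_right_distrib matrix_inv_vector[OF A])
  \<comment> \<open>the guaranteed increase of the dual value per iteration while the violation exceeds \<open>\<epsilon>\<close>\<close>
  define \<delta> where "\<delta> = 3 * \<epsilon>\<^sup>2 / (16 * K * L)"
  have "0 < \<delta>" using \<open>0 < \<epsilon>\<close> L N NK by (simp add: \<delta>_def)
  have step: "D t + \<delta> \<le> D (Suc t)" if "int t \<le> \<lceil>?bound\<rceil>" for t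
  proof -
    have upd: "lmin (Suc t) = proj_nonneg (lmin t + (1 / L) *\<^sub>R (vmin - voltage A d (q t)))"
      "lmax (Suc t) = proj_nonneg (lmax t + (1 / L) *\<^sub>R (voltage A d (q t) - vmax))"
      "mmin (Suc t) = proj_nonneg (mmin t + \<beta> *\<^sub>R sign_vec s (qmin - q t))"
      "mmax (Suc t) = proj_nonneg (mmax t + \<beta> *\<^sub>R sign_vec s (q t - qmax))"
      using run assms(9) by auto
    have "\<epsilon>\<^sup>2 \<le> (fes A d vmin vmax qmin qmax (q t))\<^sup>2"
      using infeasible[OF that] \<open>0 < \<epsilon>\<close> by (intro power_mono) auto
    also have "\<dots> \<le> (norm (proj_nonneg (vmin - voltage A d (q t))))\<^sup>2
      + (norm (proj_nonneg (voltage A d (q t) - vmax)))\<^sup>2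
      + (norm (proj_nonneg (qmin - q t)))\<^sup>2 + (norm (proj_nonneg (q t - qmax)))\<^sup>2"
      using q' by (intro fes_le_violations) auto
    finally have "\<delta> \<le> ((norm (proj_nonneg (vmin - voltage A d (q t))))\<^sup>2 / (2 * L)
        + (norm (proj_nonneg (voltage A d (q t) - vmax)))\<^sup>2 / (2 * L))
        + (\<beta> * norm (proj_nonneg (qmin - q t)) - L / 2 * (N * \<beta>\<^sup>2))
        + (\<beta> * norm (proj_nonneg (q t - qmax)) - L / 2 * (N * \<beta>\<^sup>2))"
      unfolding \<delta>_def using progress_while_infeasible[OF \<open>0 < \<epsilon>\<close> L N NK \<beta>] by simp
    then show ?thesis
      using dual_ascent[OF A assms(8) stat[of t] stat[of "Suc t"], of d vmin vmax qmin qmax]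
        gradient_step_gain[OF nonneg(1)[of t] L, of "vmin - voltage A d (q t)", folded upd]
        gradient_step_gain[OF nonneg(2)[of t] L, of "voltage A d (q t) - vmax", folded upd]
        sign_step_gain[OF nonneg(3)[of t] L \<open>0 < \<beta>\<close> assms(5), of "qmin - q t", folded upd N_def]
        sign_step_gain[OF nonneg(4)[of t] L \<open>0 < \<beta>\<close> assms(5), of "q t - qmax", folded upd N_def]
      unfolding D_def by linarith
  qed
  have D0: "D 0 = 0"
  proof -
    have "q 0 = 0" using run by (metis diff_self add.right_neutral matrix_vector_mult_0_right)
    then show ?thesis using run by (simp add: D_def lagrangian_def)
  qed
  have growth: "real t * \<delta> \<le> D t" if "int t \<le> \<lceil>?bound\<rceil> + 1" for t
    using that
  proof (induction t)
    case (Suc t)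
    then show ?case using step[of t] by (simp add: algebra_simps)
  qed (simp add: D0)
  have Q: "q' \<bullet> q' \<le> N * Q" unfolding N_def assms(11) using q' by (intro box_norm_bound)
  have "0 \<le> N * Q" using Q by (meson inner_ge_zero order_trans)
  then have "0 \<le> Q" using N by (simp add: zero_le_mult_iff)
  have lam: "0 \<le> lambda_max A" using A by (rule lambda_max_nonneg)
  have bound0: "0 \<le> ?bound" using L \<open>0 \<le> Q\<close> lam by simp
  \<comment> \<open>one step beyond the claimed bound, so that the contradiction is strict even if the bound is zero\<close>
  define T where "T = nat (\<lceil>?bound\<rceil> + 1)"
  have T: "int T = \<lceil>?bound\<rceil> + 1" using bound0 by (simp add: T_def)
  have "?bound < real T" using T by linarith
  have "N * Q * lambda_max A / 2 \<le> 3 * N * Q * lambda_max A"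
    using mult_nonneg_nonneg[OF \<open>0 \<le> N * Q\<close> lam] by simp
  also have "\<dots> = 3 * N^3 * Q * lambda_max A / N\<^sup>2"
    using N by (simp add: field_simps power2_eq_square power3_eq_cube)
  also have "\<dots> \<le> 3 * N^3 * Q * lambda_max A / K"
    using KN N NK \<open>0 \<le> Q\<close> lam by (intro divide_left_mono) auto
  also have "\<dots> = ?bound * \<delta>"
    using L N NK \<open>0 < \<epsilon>\<close> by (simp add: \<delta>_def N_def field_simps)
  also have "\<dots> < real T * \<delta>"
    using \<open>?bound < real T\<close> \<open>0 < \<delta>\<close> by (rule mult_strict_right_mono)
  also have "\<dots> \<le> D T" using growth T by simp
  also have "\<dots> \<le> (q' \<bullet> (A *v q')) / 2"
    unfolding D_def using A stat nonneg q' by (intro weak_duality) auto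
  also have "\<dots> \<le> lambda_max A * (N * Q) / 2"
    using quadratic_form_le_lambda_max[OF A, of q'] mult_left_mono[OF Q lam] by simp
  finally show False by (simp add: mult_ac)
qed

end
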